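(* Let $n \geq 2$ be an integer. Let $\alpha_n$ and $\beta_n$ be the smallest and the largest zeros of the polynomial $U_{n-1}\left(\frac{z}{2}+1\right)$ in $z$, where $$\alpha_n = 2\cos\left(\frac{n-1}{n}\,\pi\right)-2, \qquad \beta_n = 2\cos\left(\frac{1}{n}\,\pi\right)-2.$$ Then the zeros of the polynomial $L_{n-1}^{(1)}(-z)$ in $z$ are contained in the interval $[\alpha_n (n-1),\ \beta_n]$.
   Context: $U_m$ denotes the $m$th Chebyshev polynomial of the second kind, i.e. $U_m(\cos\theta)\sin\theta = \sin((m+1)\theta)$. $L_m^{(1)}$ denotes the $m$th $1$-associated Laguerre polynomial, $L_m^{(1)}(z)=\sum_{k=0}^{m}\binom{m+1}{m-k}\frac{(-z)^k}{k!}$. In the paper these arise as follows. Define $P_0^{\mathrm{id}}(z)=Q_0^{\mathrm{id}}(z)=1$ and, for $n\ge 1$, $P_n^{\mathrm{id}}(z)=\frac{z}{n}\sum_{k=1}^n k\,P_{n-k}^{\mathrm{id}}(z)$ and $Q_n^{\mathrm{id}}(z)=z\sum_{k=1}^n k\,Q_{n-k}^{\mathrm{id}}(z)$. Then, for $n\geq 1$, $P_n^{\mathrm{id}}(z)=\frac{z}{n}L_{n-1}^{(1)}(-z)$ and $Q_n^{\mathrm{id}}(z)=z\,U_{n-1}\left(\frac z2+1\right)$. *)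

theory Defs
  imports "HOL-Analysis.Analysis" "HOL-Computational_Algebra.Polynomial"
begin

definition chebyshev_U :: "nat \<Rightarrow> 'a::{real_normed_field,banach} poly" where
  "chebyshev_U m = (THE p. \<forall>\<theta>. poly p (cos \<theta>) * sin \<theta> = sin (of_nat (m + 1) * \<theta>))"

fun cheb_rec :: "nat \<Rightarrow> 'a::{real_normed_field,banach} poly" where
  "cheb_rec 0 = 1"
| "cheb_rec (Suc 0) = [:0, 2:]"
| "cheb_rec (Suc (Suc m)) = [:0, 2:] * cheb_rec (Suc m) - cheb_rec m"

lemma cheb_rec_sin:
  fixes \<theta> :: "'a::{real_normed_field,banach}"
  shows "poly (cheb_rec m) (cos \<theta>) * sin \<theta> = sin (of_nat (m + 1) * \<theta>)"
proof (induction m rule: cheb_rec.induct)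
  case 1
  show ?case by simp
next
  case 2
  show ?case using sin_double[of \<theta>] by (simp add: mult_ac)
next
  case (3 m)
  let ?a = "of_nat (Suc m + 1) * \<theta>"
  have 1: "of_nat (Suc (Suc m) + 1) * \<theta> = ?a + \<theta>"
    and 2: "of_nat (m + 1) * \<theta> = ?a - \<theta>"
    by (simp_all add: algebra_simps)
  have "poly (cheb_rec (Suc (Suc m))) (cos \<theta>) * sin \<theta>
      = 2 * cos \<theta> * (poly (cheb_rec (Suc m)) (cos \<theta>) * sin \<theta>) - poly (cheb_rec m) (cos \<theta>) * sin \<theta>"
    by (simp add: algebra_simps)
  also have "\<dots> = 2 * cos \<theta> * sin ?a - sin (?a - \<theta>)"
    unfolding 3 2 ..
  also have "\<dots> = sin (?a + \<theta>)"
    unfolding sin_add sin_diff by (simp add: algebra_simps)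
  finally show ?case unfolding 1 .
qed

lemma chebyshev_U_unique:
  fixes p q :: "'a::{real_normed_field,banach} poly"
  assumes "\<And>\<theta>. poly p (cos \<theta>) * sin \<theta> = poly q (cos \<theta>) * sin \<theta>"
  shows "p = q"
proof (rule ccontr)
  assume "p \<noteq> q"
  then have "finite {x. poly (p - q) x = 0}"
    by (intro poly_roots_finite) simp
  moreover have "(\<lambda>t::real. cos (of_real t :: 'a)) ` {0<..<pi} \<subseteq> {x. poly (p - q) x = 0}"
  proof safe
    fix t :: real
    assume "t \<in> {0<..<pi}"
    then have "sin t \<noteq> 0"
      using sin_gt_zero[of t] by simp
    then have "sin (of_real t :: 'a) \<noteq> 0"
      by (simp add: sin_of_real)
    then show "poly (p - q) (cos (of_real t)) = 0"
      using assms[of "of_real t"] by simp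
  qed
  ultimately have "finite ((\<lambda>t::real. cos (of_real t :: 'a)) ` {0<..<pi})"
    by (rule rev_finite_subset)
  moreover have "inj_on (\<lambda>t::real. cos (of_real t :: 'a)) {0<..<pi}"
    by (intro inj_onI, rule cos_inj_pi) (auto simp: cos_of_real)
  ultimately have "finite {0<..<pi}"
    by (rule finite_imageD)
  then show False
    using infinite_Ioo[OF pi_gt_zero] by simp
qed

lemma chebyshev_U_eq_rec: "chebyshev_U m = cheb_rec m"
  unfolding chebyshev_U_def
proof (rule the_equality)
  show "\<forall>\<theta>. poly (cheb_rec m) (cos \<theta>) * sin \<theta> = sin (of_nat (m + 1) * \<theta>)"
    using cheb_rec_sin by blast
next
  fix p :: "'a poly"
  assume "\<forall>\<theta>. poly p (cos \<theta>) * sin \<theta> = sin (of_nat (m + 1) * \<theta>)"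
  then show "p = cheb_rec m"
    by (intro chebyshev_U_unique) (simp only: cheb_rec_sin)
qed

lemma chebyshev_U_sin:
  "poly (chebyshev_U m) (cos \<theta>) * sin \<theta> = sin (of_nat (m + 1) * \<theta>)"
  by (simp only: chebyshev_U_eq_rec cheb_rec_sin)

definition laguerre1 :: "nat \<Rightarrow> 'a::field_char_0 poly" where
  "laguerre1 m = (\<Sum>k\<le>m. smult (of_nat ((m + 1) choose (m - k)) / fact k) ([:0, -1:] ^ k))"

lemma poly_laguerre1:
  "poly (laguerre1 m) z = (\<Sum>k\<le>m. of_nat ((m + 1) choose (m - k)) * ((- z) ^ k / fact k))"
  by (simp add: laguerre1_def poly_sum)

text \<open>"Zero" means complex zero: having a smallest (largest) zero includes that all zeros are real.\<close>

definition smallest_zero :: "complex poly \<Rightarrow> real \<Rightarrow> bool" where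
  "smallest_zero p a \<longleftrightarrow> poly p (of_real a) = 0 \<and> (\<forall>z. poly p z = 0 \<longrightarrow> z \<in> \<real> \<and> a \<le> Re z)"

definition largest_zero :: "complex poly \<Rightarrow> real \<Rightarrow> bool" where
  "largest_zero p b \<longleftrightarrow> poly p (of_real b) = 0 \<and> (\<forall>z. poly p z = 0 \<longrightarrow> z \<in> \<real> \<and> Re z \<le> b)"

end

(* Both families satisfy a discrete string equation y(j+1) - 2 y(j) + y(j-1) = z w(j) y(j) with
   y(0) = 0 and y(1) = 1: y(j) = U_(j-1)(z/2 + 1) with w(j) = 1, and y(j) = L^(1)_(j-1)(-z) with
   w(j) = 1/j.  If z is a zero for j = n, then also y(n) = 0; pairing the equation with the
   conjugate of y shows that z is real and negative, and the discrete Wirtinger inequality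
   confines z to [alpha, beta] when w = 1, with an extra factor n - 1 at the left end when
   1/(n-1) <= w <= 1. *)

theory Submission
  imports Defs
begin

text \<open>The left side is the quadratic form of half the adjacency matrix of the path
  \<open>1, ..., n - 1\<close>. Its largest eigenvalue is \<open>cos (pi / n)\<close>, with the
  positive eigenvector \<open>sin (j * pi / n)\<close>.\<close>

lemma discrete_wirtinger:
  fixes r :: "nat \<Rightarrow> real"
  assumes n: "n \<ge> 2" and r0: "r 0 = 0" and rn: "r n = 0"
  shows "(\<Sum>j<n. r j * r (Suc j)) \<le> cos (pi / n) * (\<Sum>j<n. (r j)\<^sup>2)"
proof -
  define \<theta> where "\<theta> = pi / n"
  define s where "s j = sin (real j * \<theta>)" for j
  \<comment> \<open>The denominators \<open>s 0\<close> and \<open>s n\<close> vanish, but there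
    \<open>r\<close> vanishes too, so \<open>T\<close> is 0 at both ends and the telescoped sum
    leaves nothing.\<close>
  define T where "T j = s (j - 1) / s j * (r j)\<^sup>2" for j
  have s_pos: "s j > 0" if "0 < j" "j < n" for j
    unfolding s_def
  proof (rule sin_gt_zero)
    show "0 < real j * \<theta>" using that n by (simp add: \<theta>_def)
    show "real j * \<theta> < pi" using that n by (simp add: \<theta>_def field_simps)
  qed
  have s_rec: "s (Suc (Suc j)) = 2 * cos \<theta> * s (Suc j) - s j" for j
  proof -
    have "s (Suc (Suc j)) = sin (real (Suc j) * \<theta> + \<theta>)"
      unfolding s_def by (simp add: algebra_simps)
    moreover have "s j = sin (real (Suc j) * \<theta> - \<theta>)"
      unfolding s_def by (simp add: algebra_simps)
    ultimately show ?thesis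
      by (simp add: s_def sin_add sin_diff)
  qed
  \<comment> \<open>AM-GM weighted by the extremal vector s; by its recurrence the error telescopes.\<close>
  have step: "2 * (r j * r (Suc j)) \<le> 2 * cos \<theta> * (r j)\<^sup>2 + (T (Suc j) - T j)" if j: "j < n" for j
  proof (cases j)
    case 0
    then show ?thesis by (simp add: T_def r0 s_def)
  next
    case (Suc i)
    have pos: "s j > 0" using s_pos j Suc by simp
    have "2 * cos \<theta> = s (Suc j) / s j + s (j - 1) / s j"
      using s_rec[of i] pos Suc by (simp add: field_simps)
    then have eq: "2 * cos \<theta> * (r j)\<^sup>2 + (T (Suc j) - T j)
        = s (Suc j) / s j * (r j)\<^sup>2 + s j / s (Suc j) * (r (Suc j))\<^sup>2"
      by (simp only: T_def ring_distribs) simp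
    show ?thesis
    \<comment> \<open>At the right end \<open>s n = 0\<close> and no square can be completed; both
      sides are then 0 because \<open>r n = 0\<close>.\<close>
    proof (cases "Suc j = n")
      case True
      then have "s (Suc j) = 0" using n by (simp add: s_def \<theta>_def)
      then show ?thesis unfolding eq using True rn by simp
    next
      case False
      then have pos': "s (Suc j) > 0" using s_pos j by simp
      have "s (Suc j) / s j * (r j)\<^sup>2 + s j / s (Suc j) * (r (Suc j))\<^sup>2 - 2 * (r j * r (Suc j))
          = s j * s (Suc j) * (r j / s j - r (Suc j) / s (Suc j))\<^sup>2"
        using pos pos' by (simp add: field_simps power2_eq_square)
      also have "\<dots> \<ge> 0" using pos pos' by simp
      finally show ?thesis unfolding eq by simp
    qed
  qed
  have "2 * (\<Sum>j<n. r j * r (Suc j)) \<le> (\<Sum>j<n. 2 * cos \<theta> * (r j)\<^sup>2 + (T (Suc j) - T j))"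
    unfolding sum_distrib_left by (rule sum_mono) (use step in simp)
  also have "\<dots> = 2 * cos \<theta> * (\<Sum>j<n. (r j)\<^sup>2) + (T n - T 0)"
    by (simp only: sum.distrib sum_distrib_left sum_lessThan_telescope)
  also have "T n - T 0 = 0" by (simp add: T_def r0 rn)
  finally show ?thesis by (simp add: \<theta>_def)
qed

text \<open>Pairing with \<open>cnj y\<close> gives \<open>z * S = 2 * Re A - 2 * N\<close>, which
  lies between \<open>-2 * (1 + cos (pi / n)) * N\<close> and
  \<open>-2 * (1 - cos (pi / n)) * N\<close>. Both factors of \<open>N\<close> are nonpositive, so
  the upper bound for \<open>z\<close> needs only \<open>S \<le> N\<close>, while the lower one
  needs \<open>N \<le> M * S\<close> and picks up the factor \<open>M\<close>.\<close>

lemma string_eigenvalue_bounds: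
  fixes y :: "nat \<Rightarrow> complex" and w :: "nat \<Rightarrow> real" and M :: real
  assumes n: "n \<ge> 2" and M: "M > 0"
    and y0: "y 0 = 0" and y1: "y 1 \<noteq> 0" and yn: "y n = 0"
    and rec: "\<And>j. Suc j < n \<Longrightarrow>
      y (Suc (Suc j)) - 2 * y (Suc j) + y j = z * of_real (w (Suc j)) * y (Suc j)"
    and w: "\<And>j. 0 < j \<Longrightarrow> j < n \<Longrightarrow> 1 / M \<le> w j \<and> w j \<le> 1"
  shows "z \<in> \<real>" "- (2 + 2 * cos (pi / n)) * M \<le> Re z" "Re z \<le> 2 * cos (pi / n) - 2"
proof -
  define m where "m = n - 1"
  have nm: "n = Suc m" using n by (simp add: m_def)
  define A where "A = (\<Sum>j<n. cnj (y j) * y (Suc j))"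
  define N where "N = (\<Sum>j<n. (cmod (y j))\<^sup>2)"
  define S where "S = (\<Sum>j<n. w j * (cmod (y j))\<^sup>2)"
  have shift: "(\<Sum>j<n. f j) = (\<Sum>j<m. f (Suc j))" if "f 0 = 0" for f :: "nat \<Rightarrow> 'b::comm_monoid_add"
    using that unfolding nm by (simp only: sum.lessThan_Suc_shift add_0)
  \<comment> \<open>Summation by parts: \<open>A\<close> loses its first term by
    \<open>y 0 = 0\<close>, \<open>cnj A\<close> its last by \<open>y n = 0\<close>. The two
    neighbour terms of the equation thus contribute conjugate numbers, which is why \<open>z\<close>
    comes out real.\<close>
  have A1: "A = (\<Sum>j<m. cnj (y (Suc j)) * y (Suc (Suc j)))"
    unfolding A_def by (rule shift) (simp add: y0)
  have A2: "cnj A = (\<Sum>j<m. cnj (y (Suc j)) * y j)"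
    using yn by (simp add: A_def nm mult.commute)
  have N': "N = (\<Sum>j<m. (cmod (y (Suc j)))\<^sup>2)" unfolding N_def by (rule shift) (simp add: y0)
  have S': "S = (\<Sum>j<m. w (Suc j) * (cmod (y (Suc j)))\<^sup>2)"
    unfolding S_def by (rule shift) (simp add: y0)
  have "z * of_real S = (\<Sum>j<m. cnj (y (Suc j)) * (z * of_real (w (Suc j)) * y (Suc j)))"
    unfolding S' of_real_sum sum_distrib_left
    by (intro sum.cong refl) (simp add: complex_norm_square mult_ac del: of_real_power)
  also have "\<dots> = (\<Sum>j<m. cnj (y (Suc j)) * (y (Suc (Suc j)) - 2 * y (Suc j) + y j))"
    by (intro sum.cong refl) (simp add: rec nm)
  also have "\<dots> = A - 2 * of_real N + cnj A"
    unfolding A2 unfolding A1 N' of_real_sum sum_distrib_left sum.distrib[symmetric] sum_subtractf[symmetric]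
    by (intro sum.cong refl) (simp add: complex_norm_square algebra_simps del: of_real_power)
  also have "\<dots> = of_real (2 * Re A - 2 * N)"
    by (simp add: complex_eq_iff)
  finally have zS: "z * of_real S = of_real (2 * Re A - 2 * N)" .
  have N_pos: "N > 0"
  proof -
    have "(cmod (y 1))\<^sup>2 \<le> N"
      unfolding N_def by (rule member_le_sum) (use n in auto)
    then show ?thesis using y1 by (smt (verit) zero_less_norm_iff zero_less_power)
  qed
  have S_le: "S \<le> N"
    unfolding S' N' by (intro sum_mono mult_left_le_one_le) (use w M nm in \<open>auto intro: order_trans[of _ "1 / M"]\<close>)
  have N_le: "N \<le> M * S"
    unfolding S' N' sum_distrib_left
  proof (rule sum_mono)
    fix j assume "j \<in> {..<m}"
    then have "1 \<le> M * w (Suc j)" using w[of "Suc j"] M nm by (simp add: field_simps)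
    then show "(cmod (y (Suc j)))\<^sup>2 \<le> M * (w (Suc j) * (cmod (y (Suc j)))\<^sup>2)"
      using mult_right_mono[of 1 "M * w (Suc j)" "(cmod (y (Suc j)))\<^sup>2"] by (simp add: mult.assoc)
  qed
  have S_pos: "S > 0"
    using N_pos N_le M by (smt (verit) mult_nonneg_nonpos)
  have z: "z = of_real ((2 * Re A - 2 * N) / S)"
    using zS S_pos by (simp add: field_simps)
  then show "z \<in> \<real>" by (metis Reals_of_real)
  \<comment> \<open>The inequality for real sequences is applied to the moduli of \<open>y\<close>.
    Bounding \<open>cmod A\<close> controls \<open>Re A\<close> from both sides, so one estimate
    serves both ends of the interval.\<close>
  have "cmod A \<le> (\<Sum>j<n. cmod (y j) * cmod (y (Suc j)))"
    unfolding A_def by (rule order_trans[OF norm_sum]) (simp add: norm_mult)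
  also have "\<dots> \<le> cos (pi / n) * N"
    unfolding N_def by (rule discrete_wirtinger) (use n y0 yn in auto)
  finally have A_le: "\<bar>Re A\<bar> \<le> cos (pi / n) * N"
    using abs_Re_le_cmod[of A] by linarith
  have Re_z: "Re z * S = 2 * Re A - 2 * N"
    using z S_pos by simp
  have "Re z * S \<le> (2 * cos (pi / n) - 2) * N"
    using A_le Re_z by (simp add: algebra_simps)
  also have "\<dots> \<le> (2 * cos (pi / n) - 2) * S"
    by (rule mult_left_mono_neg[OF S_le]) simp
  finally show "Re z \<le> 2 * cos (pi / n) - 2" using S_pos by simp
  have "(- (2 + 2 * cos (pi / n)) * M) * S = - (2 + 2 * cos (pi / n)) * (M * S)" by simp
  also have "\<dots> \<le> - (2 + 2 * cos (pi / n)) * N"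
    by (rule mult_left_mono_neg[OF N_le]) (use cos_ge_minus_one[of "pi / n"] in linarith)
  also have "\<dots> \<le> Re z * S"
    using A_le Re_z by (simp add: algebra_simps)
  finally show "- (2 + 2 * cos (pi / n)) * M \<le> Re z" using S_pos by simp
qed

text \<open>At the argument \<open>1 + z / 2\<close> the coefficient in the Chebyshev recurrence is
  \<open>2 + z\<close>, which turns it into the string equation of constant weight 1.\<close>

lemma chebyshev_U_zero_bounds:
  fixes z :: complex
  assumes n: "n \<ge> 2" and z: "poly (chebyshev_U (n - 1)) (1 + z / 2) = 0"
  shows "z \<in> \<real>" "- (2 + 2 * cos (pi / n)) \<le> Re z" "Re z \<le> 2 * cos (pi / n) - 2"
proof -
  \<comment> \<open>The index is shifted by one, and \<open>y 0 = 0\<close> plays the part of the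
    polynomial of index -1, so that the recurrence already holds at \<open>j = 0\<close>.\<close>
  define y where "y j = (if j = 0 then 0 else poly (cheb_rec (j - 1)) (1 + z / 2))" for j
  have "y n = 0" "y 0 = 0" "y 1 \<noteq> 0" using n z by (auto simp: y_def chebyshev_U_eq_rec)
  moreover have "y (Suc (Suc j)) - 2 * y (Suc j) + y j = z * of_real 1 * y (Suc j)" for j
    by (cases j) (simp_all add: y_def algebra_simps)
  ultimately show "z \<in> \<real>" "- (2 + 2 * cos (pi / n)) \<le> Re z" "Re z \<le> 2 * cos (pi / n) - 2"
    using string_eigenvalue_bounds[of n 1 y z "\<lambda>_. 1"] n by auto
qed

text \<open>Binomial symmetry makes the lower index independent of \<open>j\<close>, and the terms
  beyond \<open>j\<close> vanish. Consecutive polynomials can therefore be compared coefficientwise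
  over a common range \<open>N\<close>.\<close>

lemma poly_laguerre1_minus:
  fixes z :: "'a::field_char_0"
  assumes "j > 0" "j \<le> N"
  shows "poly (laguerre1 (j - 1)) (- z) = (\<Sum>k<N. of_nat (j choose Suc k) * (z ^ k / fact k))"
proof -
  have "poly (laguerre1 (j - 1)) (- z) = (\<Sum>k<j. of_nat (j choose Suc k) * (z ^ k / fact k))"
    unfolding poly_laguerre1
  proof (rule sum.cong)
    fix k assume k: "k \<in> {..<j}"
    have "j choose (j - 1 - k) = j choose Suc k"
      using k binomial_symmetric[of "Suc k" j] by simp
    then show "of_nat ((j - 1 + 1) choose (j - 1 - k)) * ((- (- z)) ^ k / fact k)
        = of_nat (j choose Suc k) * (z ^ k / fact k)"
      using assms by simp
  qed (use assms in auto)
  also have "\<dots> = (\<Sum>k<N. of_nat (j choose Suc k) * (z ^ k / fact k))"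
    using assms by (intro sum.mono_neutral_left) auto
  finally show ?thesis .
qed

text \<open>By Pascal's rule the second difference of the binomials is \<open>j choose k\<close>,
  and absorption gives \<open>Suc j * (j choose k) = Suc k * (Suc j choose Suc k)\<close>. The
  negative term is moved across to stay within the naturals.\<close>

lemma binomial_second_difference:
  "Suc j * (Suc (Suc j) choose Suc (Suc k)) + Suc j * (j choose Suc (Suc k))
    = 2 * Suc j * (Suc j choose Suc (Suc k)) + Suc k * (Suc j choose Suc k)"
  using Suc_times_binomial[of k j] by (simp add: algebra_simps)

lemma laguerre1_string_equation:
  fixes z :: "'a::field_char_0"
  defines "y \<equiv> \<lambda>j. if j = 0 then 0 else poly (laguerre1 (j - 1)) (- z)"
  shows "of_nat (Suc j) * (y (Suc (Suc j)) - 2 * y (Suc j) + y j) = z * y (Suc j)"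
proof -
  define c where "c i k = (of_nat (i choose k) :: 'a)" for i k
  have y: "y i = (\<Sum>k<N. c i (Suc k) * (z ^ k / fact k))" if "i \<le> N" for i N
    using that poly_laguerre1_minus[of i N z] by (cases i) (simp_all add: y_def c_def)
  \<comment> \<open>The constant coefficient of \<open>y i\<close> is \<open>i\<close> itself, whose
    second difference is 0; only multiples of \<open>z\<close> survive.\<close>
  have diff0: "c (Suc (Suc j)) (Suc 0) - 2 * c (Suc j) (Suc 0) + c j (Suc 0) = 0"
    by (simp add: c_def)
  have diff: "of_nat (Suc j) * (c (Suc (Suc j)) (Suc (Suc k)) - 2 * c (Suc j) (Suc (Suc k))
      + c j (Suc (Suc k))) = of_nat (Suc k) * c (Suc j) (Suc k)" for k
  proof -
    have "of_nat (Suc j) * c (Suc (Suc j)) (Suc (Suc k)) + of_nat (Suc j) * c j (Suc (Suc k))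
        = 2 * of_nat (Suc j) * c (Suc j) (Suc (Suc k)) + of_nat (Suc k) * c (Suc j) (Suc k)"
      using binomial_second_difference[of j k, THEN arg_cong[where f = "of_nat :: nat \<Rightarrow> 'a"]]
      unfolding c_def of_nat_add of_nat_mult of_nat_numeral .
    then show ?thesis by algebra
  qed
  have "y (Suc (Suc j)) - 2 * y (Suc j) + y j
      = (\<Sum>k<Suc (Suc j). (c (Suc (Suc j)) (Suc k) - 2 * c (Suc j) (Suc k) + c j (Suc k))
          * (z ^ k / fact k))"
    unfolding y[of "Suc (Suc j)" "Suc (Suc j)", OF order_refl]
      y[of "Suc j" "Suc (Suc j)", OF le_SucI[OF order_refl]]
      y[of j "Suc (Suc j)", OF le_SucI[OF le_SucI[OF order_refl]]]
      sum_distrib_left sum_subtractf[symmetric] sum.distrib[symmetric]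
    by (intro sum.cong refl) (simp only: ring_distribs mult.assoc)
  also have "\<dots> = (\<Sum>k<Suc j. (c (Suc (Suc j)) (Suc (Suc k)) - 2 * c (Suc j) (Suc (Suc k))
          + c j (Suc (Suc k))) * (z ^ Suc k / fact (Suc k)))"
    by (subst sum.lessThan_Suc_shift) (simp only: diff0 mult_zero_left add_0)
  \<comment> \<open>The factor \<open>Suc k\<close> from \<open>diff\<close> reduces
    \<open>fact (Suc k)\<close> to \<open>fact k\<close>, and the index shift has freed one factor
    \<open>z\<close>.\<close>
  also have "of_nat (Suc j) * \<dots> = (\<Sum>k<Suc j. z * (c (Suc j) (Suc k) * (z ^ k / fact k)))"
    unfolding sum_distrib_left
  proof (intro sum.cong refl, unfold mult.assoc[symmetric] diff)
    fix k
    show "of_nat (Suc k) * c (Suc j) (Suc k) * (z ^ Suc k / fact (Suc k))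
        = z * c (Suc j) (Suc k) * (z ^ k / fact k)"
      by (simp add: divide_simps del: of_nat_Suc)
  qed
  also have "\<dots> = z * y (Suc j)"
    by (simp only: y[of "Suc j" "Suc j"] sum_distrib_left order_refl)
  finally show ?thesis .
qed

text \<open>The weights \<open>1 / j\<close> with \<open>0 < j < n\<close> lie between
  \<open>1 / (n - 1)\<close> and 1, hence \<open>M = n - 1\<close>.\<close>

lemma laguerre1_zero_bounds:
  fixes z :: complex
  assumes n: "n \<ge> 2" and z: "poly (laguerre1 (n - 1)) (- z) = 0"
  shows "z \<in> \<real>" "- (2 + 2 * cos (pi / n)) * (real n - 1) \<le> Re z" "Re z \<le> 2 * cos (pi / n) - 2"
proof -
  define y where "y j = (if j = 0 then 0 else poly (laguerre1 (j - 1)) (- z))" for j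
  have "y n = 0" "y 0 = 0" "y 1 \<noteq> 0" using n z by (auto simp: y_def poly_laguerre1)
  moreover have "y (Suc (Suc j)) - 2 * y (Suc j) + y j = z * of_real (1 / real (Suc j)) * y (Suc j)" for j
    using laguerre1_string_equation[of j z, folded y_def] by (simp add: field_simps del: of_nat_Suc)
  moreover have "1 / (real n - 1) \<le> 1 / real j \<and> 1 / real j \<le> 1" if "0 < j" "j < n" for j
    using that by (simp add: frac_le)
  ultimately show "z \<in> \<real>" "- (2 + 2 * cos (pi / n)) * (real n - 1) \<le> Re z"
      "Re z \<le> 2 * cos (pi / n) - 2"
    using string_eigenvalue_bounds[of n "real n - 1" y z "\<lambda>j. 1 / real j"] n by auto
qed

text \<open>Here \<open>sin (n * t) = 0\<close> while \<open>sin t\<close> is nonzero. The cases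
  \<open>k = n - 1\<close> and \<open>k = 1\<close> show that the bounds on the Chebyshev zeros are
  attained.\<close>

lemma chebyshev_U_zero:
  assumes "0 < k" "k < n"
  shows "poly (chebyshev_U (n - 1)) (of_real (cos (real k / real n * pi)) :: complex) = 0"
proof -
  define t where "t = real k / real n * pi"
  have "sin t \<noteq> 0"
    using sin_gt_zero[of t] assms by (simp add: t_def field_simps)
  moreover have "sin (real n * t) = 0"
    using assms by (simp add: t_def)
  moreover have "poly (chebyshev_U (n - 1)) (complex_of_real (cos t)) * of_real (sin t)
      = of_real (sin (real n * t))"
    using chebyshev_U_sin[of "n - 1" "complex_of_real t"] assms
    unfolding sin_of_real[symmetric] cos_of_real[symmetric] by simp
  ultimately show ?thesis by (simp add: t_def)
qed

theorem theorem1p2: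
  fixes n :: nat and \<alpha> \<beta> :: real
  assumes "n \<ge> 2"
    and "\<alpha> = 2 * cos ((real n - 1) / real n * pi) - 2"
    and "\<beta> = 2 * cos (1 / real n * pi) - 2"
  shows "smallest_zero (pcompose (chebyshev_U (n - 1)) [:1, 1 / 2:]) \<alpha>
    \<and> largest_zero (pcompose (chebyshev_U (n - 1)) [:1, 1 / 2:]) \<beta>
    \<and> {z :: complex. poly (pcompose (laguerre1 (n - 1)) [:0, -1:]) z = 0}
        \<subseteq> complex_of_real ` {\<alpha> * (real n - 1)..\<beta>}"
proof -
  have U: "poly (pcompose (chebyshev_U (n - 1)) [:1, 1 / 2:]) z
      = poly (chebyshev_U (n - 1)) (1 + z / 2)" for z :: complex
    by (simp add: poly_pcompose)
  have \<beta>: "\<beta> = 2 * cos (pi / n) - 2" using assms(3) by simp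
  \<comment> \<open>Since \<open>cos (pi - x) = - cos x\<close>, this brings \<open>\<alpha>\<close>
    into the form of the lower bounds above.\<close>
  have "(real n - 1) / real n * pi = pi - pi / n"
    using assms(1) by (simp add: field_simps)
  then have \<alpha>: "\<alpha> = - (2 + 2 * cos (pi / n))" using assms(2) by simp
  have "1 + complex_of_real \<alpha> / 2 = of_real (cos (real (n - 1) / real n * pi))"
    using assms(1) by (simp add: assms(2) of_nat_diff field_simps)
  then have U\<alpha>: "poly (chebyshev_U (n - 1)) (1 + complex_of_real \<alpha> / 2) = 0"
    using chebyshev_U_zero[of "n - 1" n] assms(1) by simp
  have "1 + complex_of_real \<beta> / 2 = of_real (cos (real 1 / real n * pi))"
    by (simp add: assms(3) field_simps)
  then have U\<beta>: "poly (chebyshev_U (n - 1)) (1 + complex_of_real \<beta> / 2) = 0"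
    using chebyshev_U_zero[of 1 n] assms(1) by simp
  have "smallest_zero (pcompose (chebyshev_U (n - 1)) [:1, 1 / 2:]) \<alpha>"
    unfolding smallest_zero_def U
    using chebyshev_U_zero_bounds[OF assms(1), folded \<alpha>] U\<alpha> by blast
  moreover have "largest_zero (pcompose (chebyshev_U (n - 1)) [:1, 1 / 2:]) \<beta>"
    unfolding largest_zero_def U
    using chebyshev_U_zero_bounds[OF assms(1), folded \<beta>] U\<beta> by blast
  moreover have "{z :: complex. poly (pcompose (laguerre1 (n - 1)) [:0, -1:]) z = 0}
      \<subseteq> complex_of_real ` {\<alpha> * (real n - 1)..\<beta>}"
  proof
    fix z :: complex
    assume "z \<in> {z. poly (pcompose (laguerre1 (n - 1)) [:0, -1:]) z = 0}"
    then have "poly (laguerre1 (n - 1)) (- z) = 0" by (simp add: poly_pcompose)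
    from laguerre1_zero_bounds[OF assms(1) this]
    have "z = of_real (Re z)" "Re z \<in> {\<alpha> * (real n - 1)..\<beta>}"
      unfolding \<alpha> \<beta> by auto
    then show "z \<in> complex_of_real ` {\<alpha> * (real n - 1)..\<beta>}" by blast
  qed
  ultimately show ?thesis by blast
qed

end
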